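(* Let $\mathcal{M}$ be an $\mathbb{R}$-computable structure. Then $\mathcal{M}$ is $F$-parameterizable.
   Context: BSS machines: $\mathbb{R}^\infty$ denotes the set of finite sequences of reals and $\mathbb{R}_\infty=\bigoplus_{i\in\mathbb{Z}}\mathbb{R}$. A machine over $\mathbb{R}$ (Blum–Shub–Smale) is a finite connected directed graph with a unique input node (carrying a linear map $\mathbb{R}^\infty\to\mathbb{R}_\infty$), computation nodes (each carrying a rational map $\mathbb{R}_\infty\to\mathbb{R}_\infty$), branch nodes (each carrying a polynomial $h:\mathbb{R}_\infty\to\mathbb{R}$, with the computation following one outgoing edge if $h\ge 0$ and the other if $h<0$), shift nodes (shifting the bi-infinite sequence left or right), and output nodes (carrying a linear map $\mathbb{R}_\infty\to\mathbb{R}^\infty$); finitely many real constants may appear as parameters. A machine computes a partial function $\mathbb{R}^\infty\to\mathbb{R}^\infty$ by following the unique path from the input node to an output node. A set is $\mathbb{R}$-computable if its characteristic function is computed by such a machine. A structure (universe a subset of $\mathbb{R}^\infty$) is $\mathbb{R}$-computable if its atomic diagram is $\mathbb{R}$-computable, i.e. its universe and each of its relations (and graphs of its functions) are $\mathbb{R}$-computable sets. $F$-parameterizability (Morozov): a structure $\mathcal{M}$ in a finite relational language $(P_n)_{n\le k}$, $P_n$ of arity $k_n$ (functions treated via their graphs), is $F$-parameterizable if there is an injection $\xi:\mathcal{M}\to\omega^\omega$ such that the image of $\xi$ is an analytic subset of Baire space and, for each $n$, the set $\{(\xi(a_i))_{i\le k_n}:\mathcal{M}\models P_n(\bar a)\}$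 is analytic. *)

theory Defs
  imports "HOL-Analysis.Analysis" "HOL-Library.Poly_Mapping" "HOL-Library.Finite_Map"
begin

text \<open>Finite sequences of reals are of type \<open>real list\<close>; the direct sum of copies of the reals
  indexed by the integers is the type of finitely supported functions below.\<close>

type_synonym bss_state = "int \<Rightarrow>\<^sub>0 real"

text \<open>Polynomials in the coordinates: monomials are finitely supported exponent functions.\<close>

type_synonym bss_poly = "(int \<Rightarrow>\<^sub>0 nat) \<Rightarrow>\<^sub>0 real"

definition poly_eval :: "bss_poly \<Rightarrow> bss_state \<Rightarrow> real" where
  "poly_eval p s = (\<Sum>m\<in>Poly_Mapping.keys p. Poly_Mapping.lookup p m *
     (\<Prod>i\<in>Poly_Mapping.keys m. Poly_Mapping.lookup s i ^ Poly_Mapping.lookup m i))"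

definition linear_eval :: "(int \<Rightarrow>\<^sub>0 real) \<Rightarrow> bss_state \<Rightarrow> real" where
  "linear_eval a s = (\<Sum>j\<in>Poly_Mapping.keys a. Poly_Mapping.lookup a j * Poly_Mapping.lookup s j)"

definition overwrite :: "bss_state \<Rightarrow> (int, real) fmap \<Rightarrow> bss_state" where
  "overwrite s u = Poly_Mapping.Abs_poly_mapping
     (\<lambda>i. case fmlookup u i of None \<Rightarrow> Poly_Mapping.lookup s i | Some r \<Rightarrow> r)"

lemma lookup_overwrite:
  "Poly_Mapping.lookup (overwrite s u) i =
     (case fmlookup u i of None \<Rightarrow> Poly_Mapping.lookup s i | Some r \<Rightarrow> r)"
proof -
  have "{i. (case fmlookup u i of None \<Rightarrow> Poly_Mapping.lookup s i | Some r \<Rightarrow> r) \<noteq> 0}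
      \<subseteq> Poly_Mapping.keys s \<union> fset (fmdom u)"
    by (auto simp: in_keys_iff fmdom_notI split: option.splits)
  then have "finite {i. (case fmlookup u i of None \<Rightarrow> Poly_Mapping.lookup s i | Some r \<Rightarrow> r) \<noteq> 0}"
    by (rule finite_subset) simp
  then show ?thesis
    unfolding overwrite_def by simp
qed

text \<open>A machine is a finite object, so its linear and rational maps are given by finitely many
  real coefficients: finitely many coordinates are replaced by a linear form, respectively by a
  quotient of polynomials, in finitely many coordinates, and all other coordinates are kept.
  A rational map is undefined where one of its denominators vanishes.\<close>

type_synonym bss_linear = "(int, int \<Rightarrow>\<^sub>0 real) fmap"

type_synonym bss_rational = "(int, bss_poly \<times> bss_poly) fmap"

definition linear_apply :: "bss_linear \<Rightarrow> bss_state \<Rightarrow> bss_state" where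
  "linear_apply L s = overwrite s (fmmap (\<lambda>a. linear_eval a s) L)"

definition rational_wf :: "bss_rational \<Rightarrow> bool" where
  "rational_wf g \<longleftrightarrow> (\<forall>(p, q)\<in>fmran' g. q \<noteq> 0)"

definition rational_defined :: "bss_rational \<Rightarrow> bss_state \<Rightarrow> bool" where
  "rational_defined g s \<longleftrightarrow> (\<forall>(p, q)\<in>fmran' g. poly_eval q s \<noteq> 0)"

definition rational_apply :: "bss_rational \<Rightarrow> bss_state \<Rightarrow> bss_state" where
  "rational_apply g s = overwrite s (fmmap (\<lambda>(p, q). poly_eval p s / poly_eval q s) g)"

text \<open>The shifts are \<open>(\<sigma>\<^sub>l x)\<^sub>i = x\<^sub>i\<^sub>+\<^sub>1\<close> and \<open>(\<sigma>\<^sub>r x)\<^sub>i = x\<^sub>i\<^sub>-\<^sub>1\<close>.\<close>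

datatype shift_dir = Shift_Left | Shift_Right

fun shift_apply :: "shift_dir \<Rightarrow> bss_state \<Rightarrow> bss_state" where
  "shift_apply Shift_Left s = Poly_Mapping.map_key (\<lambda>i. i + 1) s"
| "shift_apply Shift_Right s = Poly_Mapping.map_key (\<lambda>i. i - 1) s"

text \<open>The input convention of Blum, Cucker, Shub and Smale: a sequence of length \<open>n\<close> is placed at
  the coordinates \<open>1, \<dots>, n\<close>, and its length is recorded by \<open>n\<close> ones at the coordinates
  \<open>0, -1, \<dots>, 1 - n\<close>. Without such a record all zero vectors, of whatever length, would be
  identified. A state is read off as a sequence by the same convention.\<close>

definition place :: "real list \<Rightarrow> bss_state" where
  "place x = Poly_Mapping.Abs_poly_mapping
     (\<lambda>i. if 1 \<le> i \<and> i \<le> int (length x) then x ! nat (i - 1)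
          else if - int (length x) < i \<and> i \<le> 0 then 1 else 0)"

definition record_length :: "bss_state \<Rightarrow> nat" where
  "record_length s = (LEAST l. Poly_Mapping.lookup s (- int l) \<noteq> 1)"

definition read_off :: "bss_state \<Rightarrow> real list" where
  "read_off s = map (\<lambda>i. Poly_Mapping.lookup s (int (Suc i))) [0..<record_length s]"

lemma lookup_place:
  "Poly_Mapping.lookup (place x) i =
     (if 1 \<le> i \<and> i \<le> int (length x) then x ! nat (i - 1)
      else if - int (length x) < i \<and> i \<le> 0 then 1 else 0)"
proof -
  have "finite {i. (if 1 \<le> i \<and> i \<le> int (length x) then x ! nat (i - 1)
      else if - int (length x) < i \<and> i \<le> 0 then 1 else (0::real)) \<noteq> 0}"
    by (rule finite_subset[of _ "{- int (length x)..int (length x)}"]) (auto split: if_splits)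
  then show ?thesis
    unfolding place_def by simp
qed

lemma read_off_place: "read_off (place x) = x"
proof -
  have "record_length (place x) = length x"
    unfolding record_length_def
    by (rule Least_equality) (auto simp: lookup_place split: if_splits)
  then show ?thesis
    by (auto simp: read_off_def lookup_place intro!: nth_equalityI)
qed

text \<open>Each node is stored with its outgoing edges. The input node maps \<open>x\<close> to
  \<open>linear_apply L (place x)\<close> and an output node maps \<open>s\<close> to \<open>read_off (linear_apply L s)\<close>. In
  \<open>Branch h v w\<close> the edge to \<open>v\<close> is taken if \<open>h \<ge> 0\<close> and the edge to \<open>w\<close> if \<open>h < 0\<close>.\<close>

datatype bss_node =
    Input bss_linear nat
  | Computation bss_rational nat
  | Branch bss_poly nat nat
  | Shift shift_dir nat
  | Output bss_linear

fun node_targets :: "bss_node \<Rightarrow> nat set" where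
  "node_targets (Input L v) = {v}"
| "node_targets (Computation g v) = {v}"
| "node_targets (Branch h v w) = {v, w}"
| "node_targets (Shift d v) = {v}"
| "node_targets (Output L) = {}"

type_synonym bss_graph = "(nat, bss_node) fmap"

definition graph_edges :: "bss_graph \<Rightarrow> (nat \<times> nat) set" where
  "graph_edges M = {(u, v). \<exists>b. fmlookup M u = Some b \<and> v \<in> node_targets b}"

definition bss_machine :: "bss_graph \<Rightarrow> bool" where
  "bss_machine M \<longleftrightarrow>
     graph_edges M \<subseteq> fmdom' M \<times> fmdom' M \<and>
     (\<forall>u\<in>fmdom' M. \<forall>v\<in>fmdom' M. (u, v) \<in> (graph_edges M \<union> (graph_edges M)\<inverse>)\<^sup>*) \<and>
     (\<exists>!u. \<exists>L v. fmlookup M u = Some (Input L v)) \<and>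
     (\<forall>u L v. fmlookup M u = Some (Input L v) \<longrightarrow> u \<notin> Range (graph_edges M)) \<and>
     (\<forall>u g v. fmlookup M u = Some (Computation g v) \<longrightarrow> rational_wf g)"

text \<open>\<open>bss_run M u s y\<close>: started at node \<open>u\<close> in state \<open>s\<close>, the machine reaches an output node and
  outputs \<open>y\<close>.\<close>

inductive bss_run :: "bss_graph \<Rightarrow> nat \<Rightarrow> bss_state \<Rightarrow> real list \<Rightarrow> bool" for M where
  run_output: "fmlookup M u = Some (Output L) \<Longrightarrow> bss_run M u s (read_off (linear_apply L s))"
| run_computation: "fmlookup M u = Some (Computation g v) \<Longrightarrow> rational_defined g s \<Longrightarrow>
    bss_run M v (rational_apply g s) y \<Longrightarrow> bss_run M u s y"
| run_branch_nonneg: "fmlookup M u = Some (Branch h v w) \<Longrightarrow> poly_eval h s \<ge> 0 \<Longrightarrow>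
    bss_run M v s y \<Longrightarrow> bss_run M u s y"
| run_branch_neg: "fmlookup M u = Some (Branch h v w) \<Longrightarrow> poly_eval h s < 0 \<Longrightarrow>
    bss_run M w s y \<Longrightarrow> bss_run M u s y"
| run_shift: "fmlookup M u = Some (Shift d v) \<Longrightarrow>
    bss_run M v (shift_apply d s) y \<Longrightarrow> bss_run M u s y"

definition bss_outputs :: "bss_graph \<Rightarrow> real list \<Rightarrow> real list \<Rightarrow> bool" where
  "bss_outputs M x y \<longleftrightarrow>
     (\<exists>u L v. fmlookup M u = Some (Input L v) \<and> bss_run M v (linear_apply L (place x)) y)"

definition bss_computes :: "bss_graph \<Rightarrow> (real list \<rightharpoonup> real list) \<Rightarrow> bool" where
  "bss_computes M f \<longleftrightarrow> (\<forall>x y. f x = Some y \<longleftrightarrow> bss_outputs M x y)"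

definition R_computable_set :: "real list set \<Rightarrow> bool" where
  "R_computable_set S \<longleftrightarrow>
     (\<exists>M. bss_machine M \<and> bss_computes M (\<lambda>x. Some [if x \<in> S then 1 else 0]))"

text \<open>A structure in a finite language: each relation and each function is stored with its arity,
  constants being functions of arity \<open>0\<close>. Tuples are lists.\<close>

record 'a fo_structure =
  universe :: "'a set"
  relations :: "(nat \<times> 'a list set) list"
  operations :: "(nat \<times> ('a list \<Rightarrow> 'a)) list"

definition tuples :: "'a set \<Rightarrow> nat \<Rightarrow> 'a list set" where
  "tuples A k = {as. length as = k \<and> set as \<subseteq> A}"

definition is_structure :: "'a fo_structure \<Rightarrow> bool" where
  "is_structure S \<longleftrightarrow>
     (\<forall>(k, P)\<in>set (relations S). P \<subseteq> tuples (universe S) k) \<and>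
     (\<forall>(k, f)\<in>set (operations S). \<forall>as\<in>tuples (universe S) k. f as \<in> universe S)"

definition relational_form :: "'a fo_structure \<Rightarrow> (nat \<times> 'a list set) list" where
  "relational_form S = relations S @
     map (\<lambda>(k, f). (Suc k, (\<lambda>as. as @ [f as]) ` tuples (universe S) k)) (operations S)"

text \<open>A tuple of finite sequences is presented to a machine as one finite sequence in which every
  entry is preceded by its length.\<close>

definition encode_tuple :: "real list list \<Rightarrow> real list" where
  "encode_tuple as = concat (map (\<lambda>x. real (length x) # x) as)"

definition R_computable_structure :: "real list fo_structure \<Rightarrow> bool" where
  "R_computable_structure S \<longleftrightarrow>
     is_structure S \<and>
     R_computable_set (universe S) \<and>
     (\<forall>(k, P)\<in>set (relational_form S). R_computable_set (encode_tuple ` P))"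

text \<open>Baire space is the type \<open>nat \<Rightarrow> nat\<close> with its product topology, the library's topology on
  function types. A set is analytic if it is empty or a continuous image of Baire space.\<close>

definition analytic_in :: "'a topology \<Rightarrow> 'a set \<Rightarrow> bool" where
  "analytic_in X A \<longleftrightarrow>
     A = {} \<or> (\<exists>f. continuous_map (euclidean :: (nat \<Rightarrow> nat) topology) X f \<and> A = f ` UNIV)"

definition F_parameterizable :: "'a fo_structure \<Rightarrow> bool" where
  "F_parameterizable S \<longleftrightarrow>
     (\<exists>\<xi> :: 'a \<Rightarrow> nat \<Rightarrow> nat.
        inj_on \<xi> (universe S) \<and>
        analytic_in euclidean (\<xi> ` universe S) \<and>
        (\<forall>(k, P)\<in>set (relational_form S).
           analytic_in (product_topology (\<lambda>_. euclidean) {..<k})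
             ((\<lambda>as. \<lambda>i\<in>{..<k}. \<xi> (as ! i)) ` P)))"

end

theory Submission
  imports Defs
begin

text \<open>For a fixed number of steps, the event that a machine halts with a given output is
  described by finitely many polynomial conditions on the state, so every computable set of
  finite sequences is Borel. Coding a real \<open>x\<close> by the integers \<open>\<lfloor>2\<^sup>j x\<rfloor>\<close> gives an
  injection \<open>\<xi>\<close> of the finite sequences into Baire space that has a Borel left inverse \<open>g\<close>. The
  image of a computable set \<open>S\<close> is then \<open>{\<alpha>. \<xi> (g \<alpha>) = \<alpha> \<and> g \<alpha> \<in> S}\<close>, a Borel set, and
  Borel subsets of Baire space are analytic. A finite power of Baire space is a continuous image
  of Baire space, which takes care of relations.\<close>

section \<open>Borel subsets of Baire space are analytic\<close>

lemma open_cylinder: "open {\<beta> :: nat \<Rightarrow> nat. \<forall>i<k. \<beta> i = \<alpha> i}"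
proof -
  have "open {\<beta> :: nat \<Rightarrow> nat. \<beta> i = \<alpha> i}" for i
  proof -
    have "continuous_on UNIV (\<lambda>\<beta> :: nat \<Rightarrow> nat. \<beta> i)"
      by (intro continuous_on_product_coordinates)
    then have "open ((\<lambda>\<beta> :: nat \<Rightarrow> nat. \<beta> i) -` {\<alpha> i})"
      by (intro open_vimage) (auto simp: open_discrete)
    then show ?thesis
      by (simp add: vimage_def)
  qed
  then have "open (\<Inter>i\<in>{..<k}. {\<beta> :: nat \<Rightarrow> nat. \<beta> i = \<alpha> i})"
    by (intro open_INT) auto
  also have "(\<Inter>i\<in>{..<k}. {\<beta>. \<beta> i = \<alpha> i}) = {\<beta>. \<forall>i<k. \<beta> i = \<alpha> i}"
    by auto
  finally show ?thesis .
qed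

lemma open_contains_cylinder:
  fixes U :: "(nat \<Rightarrow> nat) set"
  assumes "open U" "\<alpha> \<in> U"
  obtains k where "{\<beta>. \<forall>i<k. \<beta> i = \<alpha> i} \<subseteq> U"
proof -
  have "openin (product_topology (\<lambda>_. euclidean) UNIV) U"
    using assms(1) by (simp add: open_fun_def)
  then obtain X where X: "\<alpha> \<in> (\<Pi>\<^sub>E i\<in>UNIV. X i)" "finite {i. X i \<noteq> UNIV}" "(\<Pi>\<^sub>E i\<in>UNIV. X i) \<subseteq> U"
    using product_topology_open_contains_basis[OF \<open>openin _ U\<close> assms(2)]
    unfolding topspace_euclidean by (elim exE conjE)
  obtain k where k: "\<And>i. X i \<noteq> UNIV \<Longrightarrow> i < k"
    using X(2) finite_nat_set_iff_bounded by auto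
  have "\<beta> \<in> U" if "\<forall>i<k. \<beta> i = \<alpha> i" for \<beta>
  proof -
    have "\<beta> i \<in> X i" for i
      using that X(1) k[of i] by (cases "X i = UNIV") (auto simp: PiE_iff)
    then show ?thesis
      using X(3) by (auto simp: PiE_iff)
  qed
  then show thesis
    using that by blast
qed

text \<open>The target is a product of discrete factors, so continuity reduces to each output
  coordinate being locally constant, and cylinders are the neighbourhoods that witness this.\<close>

lemma continuous_on_Baire_if_locally_determined:
  fixes f :: "(nat \<Rightarrow> nat) \<Rightarrow> nat \<Rightarrow> nat"
  assumes "\<And>m \<alpha>. \<exists>k. \<forall>\<beta>. (\<forall>i<k. \<beta> i = \<alpha> i) \<longrightarrow> f \<beta> m = f \<alpha> m"
  shows "continuous_on UNIV f"
proof (rule continuous_on_coordinatewise_then_product)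
  fix m
  show "continuous_on UNIV (\<lambda>\<alpha>. f \<alpha> m)"
    unfolding continuous_on_open_vimage[OF open_UNIV]
  proof (intro allI impI)
    fix B :: "nat set"
    show "open ((\<lambda>\<alpha>. f \<alpha> m) -` B \<inter> UNIV)"
    proof (subst open_subopen, intro ballI)
      fix \<alpha> assume \<alpha>: "\<alpha> \<in> (\<lambda>\<alpha>. f \<alpha> m) -` B \<inter> UNIV"
      obtain k where k: "\<forall>\<beta>. (\<forall>i<k. \<beta> i = \<alpha> i) \<longrightarrow> f \<beta> m = f \<alpha> m"
        using assms by blast
      have "{\<beta>. \<forall>i<k. \<beta> i = \<alpha> i} \<subseteq> (\<lambda>\<alpha>. f \<alpha> m) -` B \<inter> UNIV"
      proof
        fix \<beta> assume "\<beta> \<in> {\<beta>. \<forall>i<k. \<beta> i = \<alpha> i}"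
        then have "f \<beta> m = f \<alpha> m"
          using k by blast
        with \<alpha> show "\<beta> \<in> (\<lambda>\<alpha>. f \<alpha> m) -` B \<inter> UNIV" by simp
      qed
      then show "\<exists>T. open T \<and> \<alpha> \<in> T \<and> T \<subseteq> (\<lambda>\<alpha>. f \<alpha> m) -` B \<inter> UNIV"
        using open_cylinder by blast
    qed
  qed
qed

text \<open>A point outside \<open>C\<close> is sent to a point of \<open>C\<close> that agrees with it as long as any point of
  \<open>C\<close> does.\<close>

lemma closed_Baire_retract:
  fixes C :: "(nat \<Rightarrow> nat) set"
  assumes "closed C" "C \<noteq> {}"
  obtains r :: "(nat \<Rightarrow> nat) \<Rightarrow> nat \<Rightarrow> nat" where "continuous_on UNIV r" "range r = C"
proof -
  \<comment> \<open>\<open>ext k \<alpha>\<close> says that the first \<open>k\<close> values of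
    \<alpha> form a node of the tree of \<open>C\<close>, and \<open>sel\<close> picks a point of
    \<open>C\<close> through that node. \<open>lev \<alpha>\<close> is the length of the longest
    such prefix; \<open>r\<close> consults it only outside \<open>C\<close>, where it
    exists.\<close>
  define ext where "ext k \<alpha> \<longleftrightarrow> (\<exists>\<beta>\<in>C. \<forall>i<k. \<beta> i = \<alpha> i)" for k :: nat and \<alpha>
  define sel where "sel k \<alpha> = (SOME \<beta>. \<beta> \<in> C \<and> (\<forall>i<k. \<beta> i = \<alpha> i))" for k :: nat and \<alpha> :: "nat \<Rightarrow> nat"
  define lev where "lev \<alpha> = (LEAST k. \<not> ext (Suc k) \<alpha>)" for \<alpha>
  define r where "r \<alpha> = (if \<alpha> \<in> C then \<alpha> else sel (lev \<alpha>) \<alpha>)" for \<alpha>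
  have ext_0: "ext 0 \<alpha>" for \<alpha>
    using assms by (auto simp: ext_def)
  have ext_mono: "ext l \<alpha>" if "ext k \<alpha>" "l \<le> k" for k l \<alpha>
    using that unfolding ext_def by (meson less_le_trans)
  have ext_cong: "ext k \<alpha> \<longleftrightarrow> ext k \<beta>" if "\<forall>i<k. \<beta> i = \<alpha> i" for k \<alpha> \<beta>
    using that unfolding ext_def by auto
  have sel_cong: "sel k \<beta> = sel k \<alpha>" if "\<forall>i<k. \<beta> i = \<alpha> i" for k \<alpha> \<beta>
  proof -
    \<comment> \<open>Both choices are made from the same predicate, so \<open>SOME\<close> returns
      the same point.\<close>
    have "(\<lambda>\<gamma>. \<gamma> \<in> C \<and> (\<forall>i<k. \<gamma> i = \<beta> i)) = (\<lambda>\<gamma>. \<gamma> \<in> C \<and> (\<forall>i<k. \<gamma> i = \<alpha> i))"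
      using that by auto
    then show ?thesis by (simp add: sel_def)
  qed
  have sel: "sel k \<alpha> \<in> C \<and> (\<forall>i<k. sel k \<alpha> i = \<alpha> i)" if "ext k \<alpha>" for k \<alpha>
    using that unfolding ext_def sel_def
    by (intro someI_ex[where P = "\<lambda>\<beta>. \<beta> \<in> C \<and> (\<forall>i<k. \<beta> i = \<alpha> i)"]) auto
  have ex_lev: "\<exists>k. \<not> ext (Suc k) \<alpha>" if "\<alpha> \<notin> C" for \<alpha>
  proof (rule ccontr)
    assume "\<nexists>k. \<not> ext (Suc k) \<alpha>"
    then have ex: "ext k \<alpha>" for k
      using ext_0 by (cases k) auto
    \<comment> \<open>Closedness enters here: some cylinder around \<alpha> misses \<open>C\<close>,
      so a long enough prefix leaves the tree.\<close>
    have "open (- C)" "\<alpha> \<in> - C"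
      using assms(1) that by auto
    then obtain k where "{\<beta>. \<forall>i<k. \<beta> i = \<alpha> i} \<subseteq> - C"
      by (rule open_contains_cylinder)
    with ex[of k] show False
      unfolding ext_def by blast
  qed
  have lev: "\<not> ext (Suc (lev \<alpha>)) \<alpha>" "ext (lev \<alpha>) \<alpha>" if "\<alpha> \<notin> C" for \<alpha>
  proof -
    show "\<not> ext (Suc (lev \<alpha>)) \<alpha>"
      unfolding lev_def using ex_lev[OF that] by (rule LeastI_ex)
    show "ext (lev \<alpha>) \<alpha>"
    proof (cases "lev \<alpha>")
      case (Suc j)
      then show ?thesis
        using not_less_Least[of j "\<lambda>k. \<not> ext (Suc k) \<alpha>"] by (auto simp: lev_def)
    qed (simp add: ext_0)
  qed
  have rC: "r \<alpha> \<in> C" for \<alpha>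
    using sel[OF lev(2)] by (auto simp: r_def)
  have "range r = C"
    using rC by (auto simp: r_def image_iff) (metis r_def)
  moreover have "continuous_on UNIV r"
  proof (rule continuous_on_Baire_if_locally_determined)
    fix m \<alpha>
    show "\<exists>k. \<forall>\<beta>. (\<forall>i<k. \<beta> i = \<alpha> i) \<longrightarrow> r \<beta> m = r \<alpha> m"
    proof (cases "\<alpha> \<in> C")
      case True
      show ?thesis
      \<comment> \<open>The prefix of length \<open>Suc m\<close> lies in the tree because \<alpha>
        is in \<open>C\<close>. A nearby \<beta> outside \<open>C\<close> therefore has
        \<open>lev \<beta> > m\<close>, and \<open>sel\<close> leaves its value at \<open>m\<close>
        unchanged.\<close>
      proof (intro exI[of _ "Suc m"] allI impI)
        fix \<beta> assume *: "\<forall>i<Suc m. \<beta> i = \<alpha> i"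
        have "r \<beta> m = \<beta> m"
        proof (cases "\<beta> \<in> C")
          case False
          have "ext (Suc m) \<beta>"
            using True * unfolding ext_def by (metis)
          then have "m < lev \<beta>"
            using lev(1)[OF False] ext_mono by (meson not_less_eq_eq not_le)
          then show ?thesis
            using sel[OF lev(2)[OF False]] False by (simp add: r_def)
        qed (simp add: r_def)
        then show "r \<beta> m = r \<alpha> m"
          using True * by (simp add: r_def)
      qed
    next
      case False
      show ?thesis
      \<comment> \<open>One value past the longest good prefix is enough: it forces \<beta> out of
        \<open>C\<close> at the same level, so \<alpha> and \<beta> are sent to the same
        point.\<close>
      proof (intro exI[of _ "Suc (lev \<alpha>)"] allI impI)
        fix \<beta> assume *: "\<forall>i<Suc (lev \<alpha>). \<beta> i = \<alpha> i"
        have n: "\<not> ext (Suc (lev \<alpha>)) \<beta>"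
          using lev(1)[OF False] ext_cong[OF *] by simp
        then have "\<beta> \<notin> C"
          unfolding ext_def by blast
        moreover have "lev \<beta> = lev \<alpha>"
          unfolding lev_def[of \<beta>]
        proof (rule Least_equality)
          fix y assume y: "\<not> ext (Suc y) \<beta>"
          show "lev \<alpha> \<le> y"
          proof (rule ccontr)
            assume "\<not> lev \<alpha> \<le> y"
            then have "ext (Suc y) \<alpha>"
              using ext_mono[OF lev(2)[OF False]] by simp
            moreover have "\<forall>i<Suc y. \<beta> i = \<alpha> i"
              using * \<open>\<not> lev \<alpha> \<le> y\<close> by simp
            ultimately show False
              using ext_cong y by blast
          qed
        qed (rule n)
        ultimately show "r \<beta> m = r \<alpha> m"
          using False sel_cong[of "lev \<alpha>" \<beta> \<alpha>] * by (simp add: r_def)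
      qed
    qed
  qed
  ultimately show thesis
    using that by blast
qed

section \<open>Closure properties of analytic sets\<close>

abbreviation analytic :: "(nat \<Rightarrow> nat) set \<Rightarrow> bool" where
  "analytic \<equiv> analytic_in euclidean"

lemma analytic_iff:
  "analytic A \<longleftrightarrow> A = {} \<or> (\<exists>f :: (nat \<Rightarrow> nat) \<Rightarrow> _. continuous_on UNIV f \<and> A = range f)"
  by (simp add: analytic_in_def)

lemma analytic_in_continuous_image:
  assumes "analytic_in X A" "continuous_map X Y h"
  shows "analytic_in Y (h ` A)"
proof (cases "A = {}")
  case False
  then obtain f where "continuous_map (euclidean :: (nat \<Rightarrow> nat) topology) X f" "A = range f"
    using assms(1) by (auto simp: analytic_in_def)
  then show ?thesis
    using continuous_map_compose[OF _ assms(2)] unfolding analytic_in_def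
    by (metis image_comp)
qed (simp add: analytic_in_def)

text \<open>The set is a retract of Baire space: a forbidden value at \<open>i\<close> is replaced
  by a fixed element of \<open>A\<close>. These sets generate the sigma-algebra used below.\<close>

lemma analytic_coordinate: "analytic {\<alpha>. \<alpha> i \<in> A}"
proof (cases "A = {}")
  case False
  then obtain a where a: "a \<in> A" by blast
  define f where "f \<alpha> = \<alpha>(i := if \<alpha> i \<in> A then \<alpha> i else a)" for \<alpha> :: "nat \<Rightarrow> nat"
  have "continuous_on UNIV f"
  proof (rule continuous_on_Baire_if_locally_determined)
    fix m \<alpha>
    show "\<exists>k. \<forall>\<beta>. (\<forall>i<k. \<beta> i = \<alpha> i) \<longrightarrow> f \<beta> m = f \<alpha> m"
      by (rule exI[of _ "Suc (max m i)"]) (simp add: f_def)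
  qed
  moreover have "{\<alpha>. \<alpha> i \<in> A} = range f"
  proof (intro equalityI subsetI)
    fix \<alpha> assume "\<alpha> \<in> {\<alpha>. \<alpha> i \<in> A}"
    then have "f \<alpha> = \<alpha>" by (auto simp: f_def)
    then show "\<alpha> \<in> range f" by (metis rangeI)
  qed (auto simp: f_def a)
  ultimately show ?thesis
    by (auto simp: analytic_iff)
qed (simp add: analytic_iff)

text \<open>The value at \<open>0\<close> selects a set of the family, and the remaining values are
  the argument of its parametrization.\<close>

lemma analytic_UN:
  fixes A :: "nat \<Rightarrow> (nat \<Rightarrow> nat) set"
  assumes "\<And>n. analytic (A n)"
  shows "analytic (\<Union>n. A n)"
proof (cases "\<forall>n. A n = {}")
  case False
  then obtain n0 where n0: "A n0 \<noteq> {}" by blast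
  \<comment> \<open>Empty members have no parametrization; replacing them by a nonempty one leaves
    the union unchanged.\<close>
  define B where "B n = (if A n = {} then A n0 else A n)" for n
  have UN: "(\<Union>n. A n) = (\<Union>n. B n)"
    using n0 by (auto simp: B_def split: if_splits)
  have "\<exists>f :: (nat \<Rightarrow> nat) \<Rightarrow> _. continuous_on UNIV f \<and> B n = range f" for n
    using assms[of n] assms[of n0] n0 by (auto simp: B_def analytic_iff)
  then obtain F :: "nat \<Rightarrow> (nat \<Rightarrow> nat) \<Rightarrow> nat \<Rightarrow> nat" where F: "\<And>n. continuous_on UNIV (F n)" "\<And>n. B n = range (F n)"
    by metis
  define f where "f \<alpha> = F (\<alpha> 0) (\<lambda>k. \<alpha> (Suc k))" for \<alpha>
  have "continuous_on UNIV f"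
    unfolding continuous_on_open_vimage[OF open_UNIV]
  proof (intro allI impI)
    fix U :: "(nat \<Rightarrow> nat) set" assume U: "open U"
    have tail: "continuous_on UNIV (\<lambda>\<alpha> :: nat \<Rightarrow> nat. F n (\<lambda>k. \<alpha> (Suc k)))" for n
      by (rule continuous_on_compose2[OF F(1)])
        (auto intro!: continuous_on_coordinatewise_then_product continuous_on_product_coordinates)
    \<comment> \<open>On the clopen set of points with value \<open>n\<close> at \<open>0\<close>,
      the map \<open>f\<close> is \<open>F n\<close> applied to the tail; the preimage is glued from
      these pieces.\<close>
    have "open ({\<alpha>. \<forall>i<1. \<alpha> i = n} \<inter> (\<lambda>\<alpha>. F n (\<lambda>k. \<alpha> (Suc k))) -` U)" for n
      using tail U by (intro open_Int open_cylinder[where \<alpha> = "\<lambda>_. n"]) (auto intro: open_vimage)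
    then have "open (\<Union>n. {\<alpha>. \<forall>i<1. \<alpha> i = n} \<inter> (\<lambda>\<alpha>. F n (\<lambda>k. \<alpha> (Suc k))) -` U)"
      by blast
    also have "(\<Union>n. {\<alpha>. \<forall>i<1. \<alpha> i = n} \<inter> (\<lambda>\<alpha>. F n (\<lambda>k. \<alpha> (Suc k))) -` U) = f -` U \<inter> UNIV"
      by (auto simp: f_def)
    finally show "open (f -` U \<inter> UNIV)" .
  qed
  moreover have "(\<Union>n. B n) = range f"
  proof (intro equalityI subsetI)
    fix x assume "x \<in> (\<Union>n. B n)"
    then obtain n \<beta> where "x = F n \<beta>" by (auto simp: F(2))
    then have "x = f (case_nat n \<beta>)" by (simp add: f_def)
    then show "x \<in> range f" by simp
  qed (auto simp: f_def F(2))
  ultimately show ?thesis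
    using UN by (auto simp: analytic_iff)
qed (simp add: analytic_iff)

text \<open>One point of Baire space codes a sequence of arguments, one for each parametrization.
  The sequences on which all parametrizations agree form a closed set, onto which Baire space
  retracts; the common value then parametrizes the intersection.\<close>

lemma analytic_INT:
  fixes A :: "nat \<Rightarrow> (nat \<Rightarrow> nat) set"
  assumes "\<And>n. analytic (A n)"
  shows "analytic (\<Inter>n. A n)"
proof (cases "(\<Inter>n. A n) = {}")
  case False
  then have "\<exists>f :: (nat \<Rightarrow> nat) \<Rightarrow> _. continuous_on UNIV f \<and> A n = range f" for n
    using assms[of n] by (auto simp: analytic_iff)
  then obtain F :: "nat \<Rightarrow> (nat \<Rightarrow> nat) \<Rightarrow> nat \<Rightarrow> nat" where F: "\<And>n. continuous_on UNIV (F n)" "\<And>n. A n = range (F n)"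
    by metis
  define G where "G n \<alpha> = F n (\<lambda>k. \<alpha> (prod_encode (n, k)))" for n \<alpha>
  define C where "C = (\<Inter>n. {\<alpha>. G n \<alpha> = G 0 \<alpha>})"
  have contG: "continuous_on UNIV (G n)" for n
    unfolding G_def by (rule continuous_on_compose2[OF F(1)])
      (auto intro!: continuous_on_coordinatewise_then_product continuous_on_product_coordinates)
  have "closed {\<alpha>. G n \<alpha> = G 0 \<alpha>}" for n
  proof -
    have "closed {\<alpha>. G n \<alpha> m = G 0 \<alpha> m}" for m
      by (intro closed_Collect_eq continuous_on_product_then_coordinatewise[OF contG])
    then have "closed {\<alpha>. \<forall>m. G n \<alpha> m = G 0 \<alpha> m}"
      by (rule closed_Collect_all)
    then show ?thesis
      by (simp add: fun_eq_iff)
  qed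
  then have "closed C"
    unfolding C_def by (intro closed_INT ballI)
  have eq: "(\<Inter>n. A n) = G 0 ` C"
  proof (intro equalityI subsetI)
    fix x assume "x \<in> (\<Inter>n. A n)"
    then have "\<forall>n. \<exists>\<beta>. x = F n \<beta>" by (auto simp: F(2))
    then obtain b where b: "\<And>n. x = F n (b n)" by metis
    define \<alpha> where "\<alpha> p = (case prod_decode p of (n, k) \<Rightarrow> b n k)" for p
    have "G n \<alpha> = x" for n
      using b[of n] by (simp add: G_def \<alpha>_def)
    then show "x \<in> G 0 ` C"
      by (intro image_eqI[of _ _ \<alpha>]) (simp_all add: C_def)
  next
    fix x assume "x \<in> G 0 ` C"
    then obtain \<alpha> where "\<alpha> \<in> C" "x = G 0 \<alpha>" by blast
    then have "G n \<alpha> = x" for n unfolding C_def by blast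
    moreover have "G n \<alpha> \<in> A n" for n by (simp add: F(2) G_def)
    ultimately show "x \<in> (\<Inter>n. A n)" by simp
  qed
  with False have "C \<noteq> {}" by auto
  with \<open>closed C\<close> obtain r :: "(nat \<Rightarrow> nat) \<Rightarrow> nat \<Rightarrow> nat"
    where r: "continuous_on UNIV r" "range r = C"
    by (rule closed_Baire_retract)
  have "continuous_on UNIV (\<lambda>\<alpha>. G 0 (r \<alpha>))"
    by (rule continuous_on_compose2[OF contG r(1)]) auto
  moreover have "(\<Inter>n. A n) = range (\<lambda>\<alpha>. G 0 (r \<alpha>))"
    unfolding eq r(2)[symmetric] by auto
  ultimately show ?thesis
    by (auto simp: analytic_iff)
qed (simp add: analytic_iff)

section \<open>From Borel sets to analytic sets\<close>

abbreviation baire :: "(nat \<Rightarrow> nat) measure" where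
  "baire \<equiv> PiM UNIV (\<lambda>_. count_space UNIV)"

lemma space_baire: "space baire = UNIV"
  by (simp add: space_PiM)

text \<open>The sets that are analytic together with their complements contain the one-coordinate
  conditions and form a sigma-algebra. Complementation only swaps the two halves; for a countable
  union, the complement is an intersection.\<close>

lemma analytic_if_sets_baire:
  assumes "A \<in> sets baire"
  shows "analytic A"
proof -
  have "A \<in> sigma_sets UNIV {{\<alpha>. \<alpha> i \<in> B} | i B. True}"
    using assms by (simp add: sets_PiM_single)
  then have "analytic A \<and> analytic (- A)"
  proof induction
    case (Basic a)
    then obtain i B where a: "a = {\<alpha>. \<alpha> i \<in> B}" by blast
    then have "- a = {\<alpha>. \<alpha> i \<in> - B}" by auto
    then show ?case using a analytic_coordinate by metis
  next
    case Empty
    have "analytic UNIV"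
      using analytic_coordinate[of 0 UNIV] by simp
    then show ?case by (simp add: analytic_iff)
  next
    case (Compl a)
    then show ?case by (simp add: Compl_eq_Diff_UNIV[symmetric])
  next
    case (Union a)
    then show ?case
      by (simp add: analytic_UN analytic_INT)
  qed
  then show ?thesis ..
qed

section \<open>Computable sets are Borel\<close>

text \<open>Measurability of a family of states is expressed coordinatewise, since every polynomial
  and linear form reads only finitely many coordinates.\<close>

definition measurable_state :: "'a measure \<Rightarrow> ('a \<Rightarrow> bss_state) \<Rightarrow> bool" where
  "measurable_state M s \<longleftrightarrow> (\<forall>i. (\<lambda>x. Poly_Mapping.lookup (s x) i) \<in> borel_measurable M)"

lemma measurable_lookup:
  "measurable_state M s \<Longrightarrow> (\<lambda>x. Poly_Mapping.lookup (s x) i) \<in> borel_measurable M"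
  by (simp add: measurable_state_def)

lemma measurable_poly_eval:
  "measurable_state M s \<Longrightarrow> (\<lambda>x. poly_eval p (s x)) \<in> borel_measurable M"
  unfolding poly_eval_def
  by (intro borel_measurable_sum borel_measurable_times borel_measurable_prod
      borel_measurable_power measurable_lookup borel_measurable_const)

lemma measurable_linear_eval:
  "measurable_state M s \<Longrightarrow> (\<lambda>x. linear_eval a (s x)) \<in> borel_measurable M"
  unfolding linear_eval_def
  by (intro borel_measurable_sum borel_measurable_times measurable_lookup borel_measurable_const)

lemma measurable_linear_apply:
  assumes "measurable_state M s"
  shows "measurable_state M (\<lambda>x. linear_apply L (s x))"
  unfolding measurable_state_def
proof
  fix i
  show "(\<lambda>x. Poly_Mapping.lookup (linear_apply L (s x)) i) \<in> borel_measurable M"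
    by (cases "fmlookup L i")
      (simp_all add: linear_apply_def lookup_overwrite assms measurable_lookup measurable_linear_eval)
qed

text \<open>Division is total, with value \<open>0\<close> at a zero denominator, so the quotients
  are Borel on the whole space. The true domain is treated separately in
  \<open>sets_rational_defined\<close>.\<close>

lemma measurable_rational_apply:
  assumes "measurable_state M s"
  shows "measurable_state M (\<lambda>x. rational_apply g (s x))"
  unfolding measurable_state_def
proof
  fix i
  show "(\<lambda>x. Poly_Mapping.lookup (rational_apply g (s x)) i) \<in> borel_measurable M"
  proof (cases "fmlookup g i")
    case (Some pq)
    then show ?thesis
      by (cases pq) (simp add: rational_apply_def lookup_overwrite assms measurable_poly_eval
          borel_measurable_divide)
  qed (simp add: rational_apply_def lookup_overwrite assms measurable_lookup)
qed

lemma measurable_shift_apply: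
  assumes "measurable_state M s"
  shows "measurable_state M (\<lambda>x. shift_apply d (s x))"
  using assms by (cases d) (simp_all add: measurable_state_def map_key.rep_eq inj_def)

lemma sets_rational_defined:
  assumes "measurable_state M s"
  shows "{x \<in> space M. rational_defined g (s x)} \<in> sets M"
proof -
  have "finite (fmran' g)"
    by (simp add: fmran'_alt_def)
  moreover have "{x \<in> space M. case pq of (p, q) \<Rightarrow> poly_eval q (s x) \<noteq> 0} \<in> sets M" for pq
    using measurable_poly_eval[OF assms, of "snd pq", measurable] by (cases pq) simp
  ultimately show ?thesis
    unfolding rational_defined_def by (intro sets.sets_Collect_finite_All)
qed

text \<open>A characteristic function outputs lists of length one, so this turns the output event
  into conditions on three coordinates.\<close>

lemma read_off_singleton_iff:
  "read_off s = [a] \<longleftrightarrow> Poly_Mapping.lookup s 0 = 1 \<and> Poly_Mapping.lookup s (-1) \<noteq> 1 \<and>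
     Poly_Mapping.lookup s 1 = a"
proof -
  let ?P = "\<lambda>l. Poly_Mapping.lookup s (- int l) \<noteq> 1"
  \<comment> \<open>The \<open>LEAST\<close> in \<open>record_length\<close> is attained: otherwise
    infinitely many coordinates would equal \<open>1\<close>, against finite support.\<close>
  have "\<exists>l. ?P l"
  proof (rule ccontr)
    assume "\<nexists>l. ?P l"
    then have "range (\<lambda>l. - int l) \<subseteq> Poly_Mapping.keys s"
      by (auto simp: in_keys_iff)
    then have "finite (range (\<lambda>l. - int l))"
      by (rule finite_subset) simp
    moreover have "inj (\<lambda>l. - int l)" by (auto simp: inj_def)
    ultimately show False
      using finite_imageD infinite_UNIV_nat by blast
  qed
  then have L: "?P (record_length s)"
    unfolding record_length_def by (rule LeastI_ex)
  have "record_length s = 1 \<longleftrightarrow> \<not> ?P 0 \<and> ?P 1"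
  proof
    assume r: "record_length s = 1"
    then have "\<not> ?P 0"
      unfolding record_length_def using not_less_Least[of 0 ?P] by simp
    with L r show "\<not> ?P 0 \<and> ?P 1" by simp
  next
    assume *: "\<not> ?P 0 \<and> ?P 1"
    show "record_length s = 1"
      unfolding record_length_def
    proof (rule Least_equality)
      fix y assume "?P y"
      with * show "1 \<le> y" by (cases y) auto
    qed (use * in simp)
  qed
  moreover have "read_off s = [a] \<longleftrightarrow> record_length s = 1 \<and> Poly_Mapping.lookup s 1 = a"
  proof -
    have "length (read_off s) = record_length s" by (simp add: read_off_def)
    then have "record_length s = 1" if "read_off s = [a]"
      using that by simp
    moreover have "read_off s = [Poly_Mapping.lookup s 1]" if "record_length s = 1"
      using that by (simp add: read_off_def)
    ultimately show ?thesis by auto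
  qed
  ultimately show ?thesis by auto
qed

text \<open>The bound counts visited nodes, the output node included, so nothing halts within
  \<open>0\<close>. An input node gives \<open>False\<close> because \<open>bss_run\<close> has no
  rule for it.\<close>

primrec runs_within :: "bss_graph \<Rightarrow> nat \<Rightarrow> nat \<Rightarrow> bss_state \<Rightarrow> real list \<Rightarrow> bool" where
  "runs_within M 0 u s y \<longleftrightarrow> False"
| "runs_within M (Suc n) u s y \<longleftrightarrow>
     (case fmlookup M u of
        None \<Rightarrow> False
      | Some b \<Rightarrow>
          (case b of
             Input L v \<Rightarrow> False
           | Computation g v \<Rightarrow> rational_defined g s \<and> runs_within M n v (rational_apply g s) y
           | Branch h v w \<Rightarrow>
               if poly_eval h s \<ge> 0 then runs_within M n v s y else runs_within M n w s y
           | Shift d v \<Rightarrow> runs_within M n v (shift_apply d s) y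
           | Output L \<Rightarrow> read_off (linear_apply L s) = y))"

text \<open>This writes halting as a countable union over step bounds, each of which can be handled
  by induction.\<close>

lemma bss_run_iff_runs_within: "bss_run M u s y \<longleftrightarrow> (\<exists>n. runs_within M n u s y)"
proof
  assume "bss_run M u s y"
  then show "\<exists>n. runs_within M n u s y"
  proof induction
    case (run_output u L s)
    then show ?case by (intro exI[of _ "Suc 0"]) simp
  next
    case (run_computation u g v s y)
    then obtain n where "runs_within M n v (rational_apply g s) y" by blast
    with run_computation show ?case by (intro exI[of _ "Suc n"]) simp
  next
    case (run_branch_nonneg u h v w s y)
    then obtain n where "runs_within M n v s y" by blast
    with run_branch_nonneg show ?case by (intro exI[of _ "Suc n"]) simp
  next
    case (run_branch_neg u h v w s y)
    then obtain n where "runs_within M n w s y" by blast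
    with run_branch_neg show ?case by (intro exI[of _ "Suc n"]) simp
  next
    case (run_shift u d v s y)
    then obtain n where "runs_within M n v (shift_apply d s) y" by blast
    with run_shift show ?case by (intro exI[of _ "Suc n"]) simp
  qed
next
  have "runs_within M n u s y \<Longrightarrow> bss_run M u s y" for n
    by (induction n arbitrary: u s)
      (auto split: option.splits bss_node.splits if_splits intro: bss_run.intros)
  then show "\<exists>n. runs_within M n u s y \<Longrightarrow> bss_run M u s y" by blast
qed

lemma sets_runs_within:
  assumes "measurable_state N s"
  shows "{x \<in> space N. runs_within M n u (s x) [a]} \<in> sets N"
  using assms
\<comment> \<open>The family \<open>s\<close> is generalized because the induction hypothesis is
  applied to the family of successor states.\<close>
proof (induction n arbitrary: u s)
  case (Suc n)
  note s = Suc.prems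
  show ?case
  proof (cases "fmlookup M u")
    case (Some b)
    show ?thesis
    proof (cases b)
      case (Computation g v)
      have "{x \<in> space N. rational_defined g (s x) \<and> runs_within M n v (rational_apply g (s x)) [a]} \<in> sets N"
        by (intro sets.sets_Collect_conj sets_rational_defined Suc.IH measurable_rational_apply s)
      with Some Computation show ?thesis by simp
    next
      case (Branch h v w)
      have h: "{x \<in> space N. poly_eval h (s x) \<ge> 0} \<in> sets N"
        using measurable_poly_eval[OF s, of h, measurable] by simp
      have "{x \<in> space N. (poly_eval h (s x) \<ge> 0 \<and> runs_within M n v (s x) [a]) \<or>
          (\<not> poly_eval h (s x) \<ge> 0 \<and> runs_within M n w (s x) [a])} \<in> sets N"
        by (intro sets.sets_Collect_conj sets.sets_Collect_disj sets.sets_Collect_neg h Suc.IH s)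
      also have "{x \<in> space N. (poly_eval h (s x) \<ge> 0 \<and> runs_within M n v (s x) [a]) \<or>
          (\<not> poly_eval h (s x) \<ge> 0 \<and> runs_within M n w (s x) [a])} =
          {x \<in> space N. runs_within M (Suc n) u (s x) [a]}"
        using Some Branch by auto
      finally show ?thesis .
    next
      case (Shift d v)
      with Some show ?thesis
        using Suc.IH[OF measurable_shift_apply[OF s]] by simp
    next
      case (Output L)
      note [measurable] = measurable_lookup[OF measurable_linear_apply[OF s, of L]]
      show ?thesis
        using Some Output by (simp add: read_off_singleton_iff)
    qed (use Some in simp)
  qed simp
qed simp

text \<open>Padding with \<open>0\<close> makes every entry a total function, so lists of varying
  length are described by the length and countably many real functions.\<close>

definition measurable_list :: "'a measure \<Rightarrow> ('a \<Rightarrow> real list) \<Rightarrow> bool" where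
  "measurable_list M f \<longleftrightarrow> (\<lambda>x. length (f x)) \<in> measurable M (count_space UNIV) \<and>
     (\<forall>i. (\<lambda>x. nth_default 0 (f x) i) \<in> borel_measurable M)"

lemma measurable_listD:
  assumes "measurable_list M f"
  shows "(\<lambda>x. length (f x)) \<in> measurable M (count_space UNIV)"
    "(\<lambda>x. nth_default 0 (f x) i) \<in> borel_measurable M"
  using assms by (simp_all add: measurable_list_def)

lemma measurable_list_compose:
  assumes "measurable_list N f" "h \<in> measurable M N"
  shows "measurable_list M (\<lambda>x. f (h x))"
  using assms unfolding measurable_list_def by (auto intro: measurable_compose[OF assms(2)])

lemma measurable_list_append:
  assumes "measurable_list M f" "measurable_list M g"
  shows "measurable_list M (\<lambda>x. f x @ g x)"
proof -
  note [measurable] = measurable_listD[OF assms(1)] measurable_listD[OF assms(2)]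
  have "(\<lambda>x. nth_default 0 (f x @ g x) i) \<in> borel_measurable M" for i
  proof -
    \<comment> \<open>The index depends on \<open>x\<close>, but through a countable-valued length;
      for each fixed length it is constant.\<close>
    have [measurable]: "(\<lambda>x. nth_default 0 (g x) (i - length (f x))) \<in> borel_measurable M"
      by (rule measurable_compose_countable[where f = "\<lambda>l x. nth_default 0 (g x) (i - l)"]) measurable
    have "(\<lambda>x. if i < length (f x) then nth_default 0 (f x) i
        else nth_default 0 (g x) (i - length (f x))) \<in> borel_measurable M"
      by measurable
    also have "(\<lambda>x. if i < length (f x) then nth_default 0 (f x) i
        else nth_default 0 (g x) (i - length (f x))) = (\<lambda>x. nth_default 0 (f x @ g x) i)"
      by (auto simp: nth_default_def nth_append fun_eq_iff)
    finally show ?thesis .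
  qed
  then show ?thesis
    by (simp add: measurable_list_def)
qed

lemma measurable_list_singleton:
  assumes "f \<in> borel_measurable M"
  shows "measurable_list M (\<lambda>x. [f x])"
proof -
  have "(\<lambda>x. nth_default 0 [f x] i) \<in> borel_measurable M" for i
    using assms by (cases i) (simp_all add: nth_default_def)
  then show ?thesis by (simp add: measurable_list_def)
qed

lemma measurable_list_encode_tuple:
  assumes "\<And>f. f \<in> set fs \<Longrightarrow> measurable_list M f"
  shows "measurable_list M (\<lambda>x. encode_tuple (map (\<lambda>f. f x) fs))"
  using assms
proof (induction fs)
  case Nil
  then show ?case by (simp add: encode_tuple_def measurable_list_def)
next
  case (Cons f fs)
  then have f: "measurable_list M f" by simp
  note [measurable] = measurable_listD(1)[OF f]
  have "measurable_list M (\<lambda>x. [real (length (f x))] @ f x @ encode_tuple (map (\<lambda>f. f x) fs))"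
    using Cons by (intro measurable_list_append measurable_list_singleton f) simp_all
  then show ?case by (simp add: encode_tuple_def)
qed

lemma measurable_state_place:
  assumes "measurable_list M f"
  shows "measurable_state M (\<lambda>x. place (f x))"
  unfolding measurable_state_def
proof
  fix i
  have "(\<lambda>x. if 1 \<le> i \<and> i \<le> int (length (f x)) then nth_default 0 (f x) (nat (i - 1))
      else if - int (length (f x)) < i \<and> i \<le> 0 then 1 else 0) \<in> borel_measurable M"
    \<comment> \<open>For a fixed length, the coordinate at \<open>i\<close> is a list entry or a
      constant.\<close>
    by (rule measurable_compose_countable[where g = "\<lambda>x. length (f x)" and
          f = "\<lambda>l x. if 1 \<le> i \<and> i \<le> int l then nth_default 0 (f x) (nat (i - 1))
            else if - int l < i \<and> i \<le> 0 then 1 else 0"])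
      (intro measurable_If measurable_listD[OF assms] sets.sets_Collect_const; simp)+
  also have "(\<lambda>x. if 1 \<le> i \<and> i \<le> int (length (f x)) then nth_default 0 (f x) (nat (i - 1))
      else if - int (length (f x)) < i \<and> i \<le> 0 then 1 else 0) =
      (\<lambda>x. Poly_Mapping.lookup (place (f x)) i)"
    by (auto simp: lookup_place nth_default_def fun_eq_iff)
  finally show "(\<lambda>x. Poly_Mapping.lookup (place (f x)) i) \<in> borel_measurable M" .
qed

text \<open>Membership in \<open>S\<close> means halting with output \<open>[1]\<close>, a countable
  union of the events treated in \<open>sets_runs_within\<close>.\<close>

lemma sets_R_computable:
  assumes "R_computable_set S" "measurable_list N f"
  shows "{x \<in> space N. f x \<in> S} \<in> sets N"
proof -
  obtain M where M: "bss_machine M" "bss_computes M (\<lambda>x. Some [if x \<in> S then 1 else 0])"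
    using assms(1) by (auto simp: R_computable_set_def)
  \<comment> \<open>The unique input node gives one starting edge and one linear map for all
    inputs.\<close>
  obtain u L v where u: "fmlookup M u = Some (Input L v)"
      "\<And>u' L' v'. fmlookup M u' = Some (Input L' v') \<Longrightarrow> u' = u"
  proof -
    have "\<exists>!u. \<exists>L v. fmlookup M u = Some (Input L v)"
      using M(1) unfolding bss_machine_def by (elim conjE)
    then show thesis
      using that by (elim ex1E exE) blast
  qed
  have "x \<in> S \<longleftrightarrow> bss_outputs M x [1]" for x
  proof -
    have "Some [if x \<in> S then 1 else 0] = Some [1 :: real] \<longleftrightarrow> bss_outputs M x [1]"
      using M(2) unfolding bss_computes_def by blast
    then show ?thesis by (simp split: if_splits)
  qed
  also have "bss_outputs M x [1] \<longleftrightarrow> bss_run M v (linear_apply L (place x)) [1]" for x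
    using u unfolding bss_outputs_def by fastforce
  finally have eq: "x \<in> S \<longleftrightarrow> (\<exists>n. runs_within M n v (linear_apply L (place x)) [1])" for x
    by (simp add: bss_run_iff_runs_within)
  show ?thesis
    unfolding eq
    by (intro sets.sets_Collect_countable_Ex sets_runs_within measurable_linear_apply
        measurable_state_place assms(2))
qed

section \<open>Coding finite sequences of reals\<close>

text \<open>A left inverse of the dyadic floor coding. Where the sequence diverges the value of
  \<open>lim\<close> is unspecified, yet the map is Borel on all of Baire space.\<close>

definition decode_real :: "(nat \<Rightarrow> nat) \<Rightarrow> real" where
  "decode_real \<beta> = lim (\<lambda>j. of_int (int_decode (\<beta> j)) / 2 ^ j)"

lemma decode_real_floor: "decode_real (\<lambda>j. int_encode \<lfloor>2 ^ j * x\<rfloor>) = x"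
proof -
  have "(\<lambda>j. of_int \<lfloor>2 ^ j * x\<rfloor> / 2 ^ j) \<longlonglongrightarrow> x"
  proof (rule tendsto_sandwich)
    \<comment> \<open>Rounding down loses at most one unit, hence at most \<open>(1/2) ^ j\<close>
      after rescaling.\<close>
    have "x - (1/2) ^ j \<le> of_int \<lfloor>2 ^ j * x\<rfloor> / 2 ^ j" for j
    proof -
      have "2 ^ j * x - 1 \<le> of_int \<lfloor>2 ^ j * x\<rfloor>" by linarith
      then have "(2 ^ j * x - 1) / 2 ^ j \<le> of_int \<lfloor>2 ^ j * x\<rfloor> / 2 ^ j"
        by (rule divide_right_mono) simp
      then show ?thesis by (simp add: diff_divide_distrib power_divide)
    qed
    then show "\<forall>\<^sub>F j in sequentially. x - (1/2) ^ j \<le> of_int \<lfloor>2 ^ j * x\<rfloor> / 2 ^ j" by simp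
    have "of_int \<lfloor>2 ^ j * x\<rfloor> / 2 ^ j \<le> x" for j
      using of_int_floor_le[of "2 ^ j * x"] by (simp add: field_simps)
    then show "\<forall>\<^sub>F j in sequentially. of_int \<lfloor>2 ^ j * x\<rfloor> / 2 ^ j \<le> x" by simp
    have "(\<lambda>j. x - (1/2) ^ j) \<longlonglongrightarrow> x - 0"
      by (intro tendsto_diff tendsto_const LIMSEQ_realpow_zero) auto
    then show "(\<lambda>j. x - (1/2) ^ j) \<longlonglongrightarrow> x" by simp
  qed simp
  then show ?thesis
    by (simp add: decode_real_def limI)
qed

text \<open>Through \<open>prod_decode\<close> a point is an array of rows. Row \<open>0\<close> is
  constantly the length, and row \<open>Suc i\<close> holds the dyadic floors of entry
  \<open>i\<close>, with \<open>0\<close> beyond the end of the list.\<close>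

definition encode_list :: "real list \<Rightarrow> nat \<Rightarrow> nat" where
  "encode_list x p = (case prod_decode p of (i, j) \<Rightarrow>
     if i = 0 then length x else int_encode \<lfloor>2 ^ j * nth_default 0 x (i - 1)\<rfloor>)"

definition decode_list :: "(nat \<Rightarrow> nat) \<Rightarrow> real list" where
  "decode_list \<alpha> = map (\<lambda>i. decode_real (\<lambda>j. \<alpha> (prod_encode (Suc i, j)))) [0..<\<alpha> (prod_encode (0, 0))]"

lemma decode_encode_list: "decode_list (encode_list x) = x"
  by (rule nth_equalityI)
    (simp_all add: decode_list_def encode_list_def decode_real_floor nth_default_def)

lemma measurable_list_decode_list: "measurable_list baire decode_list"
proof -
  have [measurable]: "(\<lambda>\<alpha>. \<alpha> p) \<in> measurable baire (count_space UNIV)" for p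
    by (rule measurable_component_singleton) simp
  have [measurable]: "(\<lambda>\<alpha>. decode_real (\<lambda>j. \<alpha> (prod_encode (i, j)))) \<in> borel_measurable baire" for i
    unfolding decode_real_def by (intro borel_measurable_lim_metric) measurable
  have "(\<lambda>\<alpha>. nth_default 0 (decode_list \<alpha>) i) \<in> borel_measurable baire" for i
  proof -
    have "(\<lambda>\<alpha>. if i < \<alpha> (prod_encode (0, 0)) then decode_real (\<lambda>j. \<alpha> (prod_encode (Suc i, j))) else 0)
        \<in> borel_measurable baire"
      by measurable
    then show ?thesis
      by (simp add: nth_default_def decode_list_def cong: if_cong)
  qed
  then show ?thesis
    by (simp add: measurable_list_def decode_list_def)
qed

text \<open>By \<open>decode_encode_list\<close> this set is the range of
  \<open>encode_list\<close>. It is Borel because equality in Baire space amounts to countably many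
  equalities of natural numbers.\<close>

lemma sets_encode_decode: "{\<alpha>. encode_list (decode_list \<alpha>) = \<alpha>} \<in> sets baire"
proof -
  note [measurable] = measurable_listD[OF measurable_list_decode_list]
  have [measurable]: "(\<lambda>\<alpha>. \<alpha> p) \<in> measurable baire (count_space UNIV)" for p
    by (rule measurable_component_singleton) simp
  have [measurable]: "(\<lambda>\<alpha>. encode_list (decode_list \<alpha>) p) \<in> measurable baire (count_space UNIV)" for p
  proof -
    obtain i j where p: "prod_decode p = (i, j)" by fastforce
    have "(\<lambda>\<alpha>. \<lfloor>2 ^ j * nth_default 0 (decode_list \<alpha>) m\<rfloor>) \<in> measurable baire (count_space UNIV)" for m
      by measurable
    then have "(\<lambda>\<alpha>. int_encode \<lfloor>2 ^ j * nth_default 0 (decode_list \<alpha>) m\<rfloor>)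
        \<in> measurable baire (count_space UNIV)" for m
      by (rule measurable_compose) simp
    then show ?thesis
      unfolding encode_list_def p
      by (cases "i = 0") (simp_all add: measurable_listD[OF measurable_list_decode_list])
  qed
  have "{\<alpha> \<in> space baire. \<forall>p. encode_list (decode_list \<alpha>) p = \<alpha> p} \<in> sets baire"
    by measurable
  then show ?thesis
    by (simp add: space_baire fun_eq_iff)
qed

text \<open>The length in front of each entry shows where that entry ends.\<close>

lemma inj_encode_tuple: "inj encode_tuple"
proof (rule injI)
  fix as bs :: "real list list"
  assume "encode_tuple as = encode_tuple bs"
  then show "as = bs"
  proof (induction as arbitrary: bs)
    case Nil
    then show ?case by (cases bs) (auto simp: encode_tuple_def)
  next
    case (Cons a as)
    then obtain b bs' where bs: "bs = b # bs'"
      by (cases bs) (auto simp: encode_tuple_def)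
    then have "length a = length b" "a @ encode_tuple as = b @ encode_tuple bs'"
      using Cons.prems by (auto simp: encode_tuple_def)
    then show ?case using Cons.IH bs by simp
  qed
qed

lemma analytic_encode_list_image:
  assumes "R_computable_set S"
  shows "analytic (encode_list ` S)"
proof -
  have "encode_list ` S = {\<alpha>. encode_list (decode_list \<alpha>) = \<alpha>} \<inter> {\<alpha> \<in> space baire. decode_list \<alpha> \<in> S}"
    by (auto simp: decode_encode_list space_baire image_iff) metis
  also have "\<dots> \<in> sets baire"
    by (intro sets.Int sets_encode_decode sets_R_computable[OF assms] measurable_list_decode_list)
  finally show ?thesis by (rule analytic_if_sets_baire)
qed

text \<open>A \<open>k\<close>-tuple of codes is stored in the first \<open>k\<close> rows of one
  point. The points storing a tuple of \<open>P\<close> form a Borel, hence analytic, set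
  \<open>A'\<close>, and the continuous map \<open>h\<close> reads the rows off.\<close>

lemma analytic_encode_list_relation:
  assumes "R_computable_set (encode_tuple ` P)" and len: "\<And>as. as \<in> P \<Longrightarrow> length as = k"
  shows "analytic_in (product_topology (\<lambda>_. euclidean) {..<k})
    ((\<lambda>as. \<lambda>i\<in>{..<k}. encode_list (as ! i)) ` P)"
proof -
  define pr where "pr i \<alpha> = (\<lambda>n. \<alpha> (prod_encode (i, n)))" for i :: nat and \<alpha> :: "nat \<Rightarrow> nat"
  define h where "h \<alpha> = (\<lambda>i\<in>{..<k}. pr i \<alpha>)" for \<alpha>
  define tup where "tup \<alpha> = map (\<lambda>i. decode_list (pr i \<alpha>)) [0..<k]" for \<alpha>
  define A' where "A' = {\<alpha>. (\<forall>i<k. encode_list (decode_list (pr i \<alpha>)) = pr i \<alpha>) \<and> tup \<alpha> \<in> P}"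
  have pr: "pr i \<in> measurable baire baire" for i
    unfolding pr_def by (rule measurable_PiM_single') (auto intro: measurable_component_singleton)
  have tup: "measurable_list baire (\<lambda>\<alpha>. encode_tuple (tup \<alpha>))"
  proof -
    have "measurable_list baire
        (\<lambda>\<alpha>. encode_tuple (map (\<lambda>f. f \<alpha>) (map (\<lambda>i \<alpha>. decode_list (pr i \<alpha>)) [0..<k])))"
      by (rule measurable_list_encode_tuple)
        (auto intro: measurable_list_compose[OF measurable_list_decode_list pr])
    then show ?thesis by (simp add: tup_def comp_def)
  qed
  have "{\<alpha>. encode_list (decode_list (pr i \<alpha>)) = pr i \<alpha>} \<in> sets baire" for i
    using measurable_sets[OF pr sets_encode_decode, of i] by (simp add: space_baire vimage_def)
  then have "{\<alpha> \<in> space baire. \<forall>i\<in>{..<k}. encode_list (decode_list (pr i \<alpha>)) = pr i \<alpha>} \<in> sets baire"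
    by (intro sets.sets_Collect_finite_All) (auto simp: space_baire)
  moreover have "{\<alpha> \<in> space baire. encode_tuple (tup \<alpha>) \<in> encode_tuple ` P} \<in> sets baire"
    by (rule sets_R_computable[OF assms(1) tup])
  ultimately have "{\<alpha> \<in> space baire. (\<forall>i\<in>{..<k}. encode_list (decode_list (pr i \<alpha>)) = pr i \<alpha>) \<and>
      encode_tuple (tup \<alpha>) \<in> encode_tuple ` P} \<in> sets baire"
    by (intro sets.sets_Collect_conj)
  then have "A' \<in> sets baire"
    \<comment> \<open>Injectivity of \<open>encode_tuple\<close> turns membership of the encoded
      tuple back into membership in \<open>P\<close>.\<close>
    by (simp add: A'_def space_baire inj_image_mem_iff[OF inj_encode_tuple] Ball_def)
  then have "analytic A'"
    by (rule analytic_if_sets_baire)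
  moreover have "continuous_map euclidean (product_topology (\<lambda>_. euclidean) {..<k}) h"
    by (auto simp: continuous_map_componentwise h_def pr_def intro!:
        continuous_on_coordinatewise_then_product continuous_on_product_coordinates)
  ultimately have "analytic_in (product_topology (\<lambda>_. euclidean) {..<k}) (h ` A')"
    by (rule analytic_in_continuous_image)
  moreover have "h ` A' = (\<lambda>as. \<lambda>i\<in>{..<k}. encode_list (as ! i)) ` P"
  proof (intro equalityI subsetI)
    fix y assume "y \<in> h ` A'"
    then obtain \<alpha> where \<alpha>: "\<alpha> \<in> A'" "y = h \<alpha>" by blast
    then have "y = (\<lambda>i\<in>{..<k}. encode_list (tup \<alpha> ! i))"
      by (auto simp: A'_def h_def tup_def restrict_def fun_eq_iff)
    moreover have "tup \<alpha> \<in> P"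
      using \<alpha> by (simp add: A'_def)
    ultimately show "y \<in> (\<lambda>as. \<lambda>i\<in>{..<k}. encode_list (as ! i)) ` P"
      by (rule image_eqI)
  next
    fix y assume "y \<in> (\<lambda>as. \<lambda>i\<in>{..<k}. encode_list (as ! i)) ` P"
    then obtain as where as: "as \<in> P" "y = (\<lambda>i\<in>{..<k}. encode_list (as ! i))" by blast
    \<comment> \<open>For rows from \<open>k\<close> on, \<open>as ! i\<close> is an unspecified
      list; \<open>A'\<close> and \<open>h\<close> look only at the first \<open>k\<close>
      rows.\<close>
    define \<alpha> where "\<alpha> p = (case prod_decode p of (i, n) \<Rightarrow> encode_list (as ! i) n)" for p
    have p: "pr i \<alpha> = encode_list (as ! i)" for i
      by (simp add: pr_def \<alpha>_def)
    have "tup \<alpha> = as"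
      using len[OF as(1)] by (auto simp: tup_def p decode_encode_list intro: nth_equalityI)
    then have "\<alpha> \<in> A'"
      using as by (simp add: A'_def p decode_encode_list)
    moreover have "y = h \<alpha>"
      by (simp add: as h_def p)
    ultimately show "y \<in> h ` A'" by blast
  qed
  ultimately show ?thesis by simp
qed

text \<open>Supplies the length condition of \<open>analytic_encode_list_relation\<close>. The graph
  of a function has arity one higher, as the value is appended to the arguments.\<close>

lemma relational_form_length:
  assumes "is_structure S" "(k, P) \<in> set (relational_form S)" "as \<in> P"
  shows "length as = k"
proof -
  consider "(k, P) \<in> set (relations S)"
    | k' f where "(k', f) \<in> set (operations S)" "k = Suc k'"
        "P = (\<lambda>as. as @ [f as]) ` tuples (universe S) k'"
    using assms(2) by (auto simp: relational_form_def)
  then show ?thesis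
  proof cases
    case 1
    then have "P \<subseteq> tuples (universe S) k"
      using assms(1) by (auto simp: is_structure_def)
    then show ?thesis
      using assms(3) by (auto simp: tuples_def)
  next
    case 2
    then show ?thesis
      using assms(3) by (auto simp: tuples_def)
  qed
qed

theorem theorem3p1:
  fixes \<M> :: "real list fo_structure"
  assumes "R_computable_structure \<M>"
  shows "F_parameterizable \<M>"
  unfolding F_parameterizable_def
proof (intro exI[of _ encode_list] conjI ballI)
  show "inj_on encode_list (universe \<M>)"
    by (metis decode_encode_list inj_on_inverseI)
  show "analytic (encode_list ` universe \<M>)"
    using assms by (intro analytic_encode_list_image) (simp add: R_computable_structure_def)
  fix kP assume kP: "kP \<in> set (relational_form \<M>)"
  obtain k P where [simp]: "kP = (k, P)" by fastforce
  have "R_computable_set (encode_tuple ` P)" "is_structure \<M>"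
    using assms kP by (auto simp: R_computable_structure_def)
  then show "case kP of (k, P) \<Rightarrow> analytic_in (product_topology (\<lambda>_. euclidean) {..<k})
      ((\<lambda>as. \<lambda>i\<in>{..<k}. encode_list (as ! i)) ` P)"
    using analytic_encode_list_relation[of P k] relational_form_length[of \<M> k P] kP by simp
qed

end
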